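(* There exists an absolute constant $C>0$ such that the following holds with high probability as $N\to\infty$. Let $N\ge 2$, $1\le K\le N-1$ and $M\ge 1$ be integers with $$M\ \ge\ C\,(NK)^{1/2}\ln N ,$$ and let $A\in\mathbb{R}^{M\times N}$ be a random matrix with i.i.d. $\mathcal{N}(0,1)$ entries. Then $A$ satisfies the TV null space condition of order $K$: for every nonzero $\bm{z}\in\mathbb{R}^N$ with $A\bm{z}=\bm{0}$ and every $\mathcal{K}\subset\{1,\dots,N-1\}$ with $|\mathcal{K}|\le K$, $$\|(D\bm{z})_{\mathcal{K}}\|_1<\|(D\bm{z})_{\mathcal{K}^c}\|_1 .$$ Precisely: for every $\eta>0$ there is $N_0$ such that for all $N\ge N_0$ and all integers $K,M$ with $1\le K\le N-1$, $M\ge 1$ and $M\ge C\,(NK)^{1/2}\ln N$, this event has probability at least $1-\eta$.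
   Context: For $\bm{x}\in\mathbb{R}^N$, $D\bm{x}\in\mathbb{R}^{N-1}$ is the finite difference vector $[D\bm{x}]_i=x_{i+1}-x_i$, $i=1,\dots,N-1$. For $\mathcal{K}\subset\{1,\dots,N-1\}$, $\mathcal{K}^c=\{1,\dots,N-1\}\setminus\mathcal{K}$, and $(D\bm{x})_{\mathcal{K}}$ denotes the restriction of $D\bm{x}$ to the indices in $\mathcal{K}$. *)

theory Defs
  imports "HOL-Probability.Probability"
begin

text \<open>
  A vector in \<open>\<real>\<^sup>N\<close> is a function \<open>nat \<Rightarrow> real\<close> of which only the values on \<open>{1..N}\<close> matter;
  an \<open>M \<times> N\<close> matrix is a function on pairs of which only the values on
  \<open>{1..M} \<times> {1..N}\<close> matter. All indices start at 1.
\<close>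

definition mat_vec :: "nat \<Rightarrow> (nat \<times> nat \<Rightarrow> real) \<Rightarrow> (nat \<Rightarrow> real) \<Rightarrow> nat \<Rightarrow> real" where
  "mat_vec N A z i = (\<Sum>j=1..N. A (i, j) * z j)"

text \<open>For \<open>x \<in> \<real>\<^sup>N\<close> the entries of the finite difference vector are used for \<open>i \<in> {1..N - 1}\<close> only.\<close>

definition fin_diff :: "(nat \<Rightarrow> real) \<Rightarrow> nat \<Rightarrow> real" where
  "fin_diff x i = x (i + 1) - x i"

definition l1_on :: "nat set \<Rightarrow> (nat \<Rightarrow> real) \<Rightarrow> real" where
  "l1_on S y = (\<Sum>i\<in>S. \<bar>y i\<bar>)"

definition tv_nsp :: "nat \<Rightarrow> nat \<Rightarrow> nat \<Rightarrow> (nat \<times> nat \<Rightarrow> real) \<Rightarrow> bool" where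
  "tv_nsp M N K A \<longleftrightarrow>
     (\<forall>z. (\<exists>j\<in>{1..N}. z j \<noteq> 0) \<and> (\<forall>i\<in>{1..M}. mat_vec N A z i = 0) \<longrightarrow>
       (\<forall>S. S \<subseteq> {1..N - 1} \<and> card S \<le> K \<longrightarrow>
         l1_on S (fin_diff z) < l1_on ({1..N - 1} - S) (fin_diff z)))"

text \<open>
  The law of an \<open>M \<times> N\<close> matrix with independent standard normal entries. Working with this law
  rather than with an arbitrary probability space keeps constants independent of the type of the
  sample space; the lemma below shows that every such random matrix has this law.
\<close>

definition gaussian_matrix :: "nat \<Rightarrow> nat \<Rightarrow> (nat \<times> nat \<Rightarrow> real) measure" where
  "gaussian_matrix M N =
     (\<Pi>\<^sub>M p \<in> {1..M} \<times> {1..N}. density lborel (\<lambda>x. ennreal (std_normal_density x)))"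

lemma distr_iid_std_normal:
  fixes X :: "nat \<times> nat \<Rightarrow> 'a \<Rightarrow> real"
  assumes "prob_space P" and "1 \<le> M" and "1 \<le> N"
    and indep: "prob_space.indep_vars P (\<lambda>_. borel) X ({1..M} \<times> {1..N})"
    and normal: "\<And>p. p \<in> {1..M} \<times> {1..N} \<Longrightarrow> distributed P lborel (X p) std_normal_density"
  shows "distr P (\<Pi>\<^sub>M p \<in> {1..M} \<times> {1..N}. borel) (\<lambda>\<omega>. \<lambda>p\<in>{1..M} \<times> {1..N}. X p \<omega>)
       = gaussian_matrix M N"
proof -
  interpret prob_space P by fact
  let ?I = "{1..M} \<times> {1..N}"
  have ne: "?I \<noteq> {}" using assms(2,3) by auto
  have rv: "\<And>p. p \<in> ?I \<Longrightarrow> random_variable borel (X p)"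
    using indep unfolding indep_vars_def by auto
  have "indep_vars (\<lambda>_. borel) X ?I \<longleftrightarrow>
      distr P (\<Pi>\<^sub>M p \<in> ?I. borel) (\<lambda>\<omega>. \<lambda>p\<in>?I. X p \<omega>) = (\<Pi>\<^sub>M p \<in> ?I. distr P borel (X p))"
    by (rule indep_vars_iff_distr_eq_PiM'[OF ne rv])
  with indep have "distr P (\<Pi>\<^sub>M p \<in> ?I. borel) (\<lambda>\<omega>. \<lambda>p\<in>?I. X p \<omega>)
      = (\<Pi>\<^sub>M p \<in> ?I. distr P borel (X p))"
    by (rule iffD1[rotated])
  also have "\<dots> = gaussian_matrix M N"
    unfolding gaussian_matrix_def
  proof (rule PiM_cong[OF refl])
    fix p assume "p \<in> ?I"
    then have "distr P lborel (X p) = density lborel std_normal_density"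
      by (rule distributed_distr_eq_density[OF normal])
    then show "distr P borel (X p) = density lborel (\<lambda>x. ennreal (std_normal_density x))"
      by (simp cong: distr_cong)
  qed
  finally show ?thesis .
qed

end

theory Submission
  imports Defs
begin

text \<open>
  Normalise a violating kernel vector to \<open>\<parallel>z\<parallel>\<^sub>2 = 1\<close>. Then \<open>\<parallel>D z\<parallel>\<^sub>1 \<le> 4 \<surd>K\<close>, and cutting \<open>{1..N}\<close> into
  blocks of length \<open>L \<approx> \<surd>(N/K)\<close> writes \<open>z\<close> as a combination of indicators of segments of length
  at most \<open>L\<close> whose coefficients have \<open>\<ell>\<^sub>1\<close>-norm \<open>r\<close> with \<open>L r\<^sup>2 = O(\<surd>(N K))\<close>. Maurey's empirical method
  approximates \<open>z\<close> and \<open>A z\<close> simultaneously by an average of \<open>m = O(\<surd>(N K))\<close> signed, rescaled segments,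
  provided that \<open>\<parallel>A s\<parallel>\<^sup>2 \<le> 8 M L\<close> for every segment \<open>s\<close>. Hence a violation forces one of at most
  \<open>(3 N\<^sup>2)\<^sup>m\<close> fixed vectors, of norm at least \<open>1/2\<close>, to have an image of squared norm at most \<open>M/200\<close>. By
  Chernoff bounds each of these events has probability at most \<open>e\<^sup>-\<^sup>M\<close>, and the union bound closes as soon as
  \<open>M\<close> is a large multiple of \<open>\<surd>(N K) ln N\<close>.
\<close>

section \<open>Maurey's empirical method\<close>

text \<open>Averaging: draw \<open>p\<close> with probability |c p|/r and \<open>s\<close> = sgn (c
  p), and use \<open>s\<close> = 0 with the remaining probability. The mean of r * s * g p is t, so
  the squared norm has mean at most |x|^2 - |t|^2 + \<beta> * r^2, and some outcome does not exceed
  the mean.\<close>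

lemma greedy_atom_step:
  fixes g :: "'p \<Rightarrow> 'k \<Rightarrow> real"
  assumes I: "finite I" "I \<noteq> {}"
    and g: "\<And>p. p \<in> I \<Longrightarrow> (\<Sum>k\<in>J. (g p k)\<^sup>2) \<le> \<beta>"
    and c: "(\<Sum>p\<in>I. \<bar>c p\<bar>) \<le> r" and r: "0 < r"
    and t: "\<And>k. k \<in> J \<Longrightarrow> t k = (\<Sum>p\<in>I. c p * g p k)"
  shows "\<exists>s\<in>{-1,0,1}. \<exists>p\<in>I.
    (\<Sum>k\<in>J. (x k + r * (s * g p k) - t k)\<^sup>2) \<le> (\<Sum>k\<in>J. (x k)\<^sup>2) + \<beta> * r\<^sup>2"
proof (rule ccontr)
  assume neg: "\<not> ?thesis"
  let ?B = "(\<Sum>k\<in>J. (x k)\<^sup>2) + \<beta> * r\<^sup>2"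
  let ?F = "\<lambda>s p. \<Sum>k\<in>J. (x k + r * (s * g p k) - t k)\<^sup>2"
  have gt: "?B < ?F s p" if "s \<in> {-1,0,1}" "p \<in> I" for s p
    using neg that by (meson not_le)
  define W where "W = (\<Sum>p\<in>I. \<bar>c p\<bar>)"
  have W: "0 \<le> W" "W \<le> r" using c by (simp_all add: W_def sum_nonneg)
  obtain p0 where p0: "p0 \<in> I" using I by blast
  have \<beta>: "0 \<le> \<beta>" using g[OF p0] by (meson order_trans sum_nonneg zero_le_power2)
  have sg: "sgn (c p) \<in> {-1,0,1}" for p by (simp add: sgn_if)
  have 1: "W * ?B \<le> (\<Sum>p\<in>I. \<bar>c p\<bar> * ?F (sgn (c p)) p)"
    unfolding W_def sum_distrib_right
    by (intro sum_mono mult_left_mono[OF less_imp_le[OF gt[OF sg]]]) auto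
  \<comment> \<open>The choice \<open>s\<close> = 0 carries the missing weight r - W; any index
    serves, since the atom is switched off.\<close>
  have 2: "(r - W) * ?B \<le> (r - W) * ?F 0 p0"
    using W gt[OF _ p0, of 0] by (intro mult_left_mono) auto
  define D where "D = (\<Sum>k\<in>J. (x k - t k)\<^sup>2)"
  define E where "E = (\<Sum>k\<in>J. (x k - t k) * t k)"
  \<comment> \<open>As |c p| * sgn (c p) = c p, summing the cross terms over \<open>p\<close>
    reproduces t.\<close>
  have Fx: "\<bar>c p\<bar> * ?F (sgn (c p)) p \<le>
      \<bar>c p\<bar> * D + 2 * r * (\<Sum>k\<in>J. (x k - t k) * (c p * g p k)) + \<bar>c p\<bar> * (r\<^sup>2 * \<beta>)"
    if p: "p \<in> I" for p
  proof -
    have "\<bar>c p\<bar> * ?F (sgn (c p)) p =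
       (\<Sum>k\<in>J. \<bar>c p\<bar> * (x k - t k)\<^sup>2 + 2 * r * ((x k - t k) * (c p * g p k))
          + \<bar>c p\<bar> * (r\<^sup>2 * (g p k)\<^sup>2))"
      unfolding sum_distrib_left
    proof (intro sum.cong refl)
      fix k
      show "\<bar>c p\<bar> * (x k + r * (sgn (c p) * g p k) - t k)\<^sup>2 =
         \<bar>c p\<bar> * (x k - t k)\<^sup>2 + 2 * r * ((x k - t k) * (c p * g p k))
          + \<bar>c p\<bar> * (r\<^sup>2 * (g p k)\<^sup>2)"
        by (cases "c p" "0::real" rule: linorder_cases)
           (simp_all add: power2_eq_square algebra_simps)
    qed
    also have "\<dots> = \<bar>c p\<bar> * D + 2 * r * (\<Sum>k\<in>J. (x k - t k) * (c p * g p k))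
        + \<bar>c p\<bar> * (r\<^sup>2 * (\<Sum>k\<in>J. (g p k)\<^sup>2))"
      by (simp add: sum.distrib sum_distrib_left D_def)
    also have "\<dots> \<le> \<bar>c p\<bar> * D + 2 * r * (\<Sum>k\<in>J. (x k - t k) * (c p * g p k))
        + \<bar>c p\<bar> * (r\<^sup>2 * \<beta>)"
      using g[OF p] by (intro add_left_mono mult_left_mono) auto
    finally show ?thesis .
  qed
  have "(\<Sum>p\<in>I. \<bar>c p\<bar> * ?F (sgn (c p)) p) \<le>
     (\<Sum>p\<in>I. \<bar>c p\<bar> * D + 2 * r * (\<Sum>k\<in>J. (x k - t k) * (c p * g p k)) + \<bar>c p\<bar> * (r\<^sup>2 * \<beta>))"
    by (intro sum_mono Fx)
  also have "\<dots> = W * D + 2 * r * (\<Sum>p\<in>I. \<Sum>k\<in>J. (x k - t k) * (c p * g p k)) + W * (r\<^sup>2 * \<beta>)"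
    by (simp add: sum.distrib sum_distrib_left sum_distrib_right W_def)
  also have "(\<Sum>p\<in>I. \<Sum>k\<in>J. (x k - t k) * (c p * g p k)) = E"
    unfolding E_def by (subst sum.swap) (simp add: t sum_distrib_left)
  finally have 3: "(\<Sum>p\<in>I. \<bar>c p\<bar> * ?F (sgn (c p)) p) \<le> W * D + 2 * r * E + W * (r\<^sup>2 * \<beta>)" .
  have 4: "?F 0 p0 = D" by (simp add: D_def)
  have 5: "D + 2 * E = (\<Sum>k\<in>J. (x k)\<^sup>2) - (\<Sum>k\<in>J. (t k)\<^sup>2)"
    unfolding D_def E_def sum_distrib_left sum.distrib[symmetric] sum_subtractf[symmetric]
    by (intro sum.cong refl) (simp add: power2_eq_square algebra_simps)
  have "r * ?B = W * ?B + (r - W) * ?B" by (simp add: algebra_simps)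
  also have "\<dots> \<le> r * (D + 2 * E) + W * (r\<^sup>2 * \<beta>)"
    using 1 2 3 4 by (simp add: algebra_simps)
  also have "\<dots> \<le> r * (D + 2 * E) + r * (r\<^sup>2 * \<beta>)"
    using W \<beta> by (intro add_left_mono mult_right_mono) auto
  finally have "r * ?B \<le> r * (D + 2 * E + r\<^sup>2 * \<beta>)" by (simp add: algebra_simps)
  then have "?B \<le> D + 2 * E + r\<^sup>2 * \<beta>" using r by simp
  \<comment> \<open>The strict bounds entered the average only in weak form, so there is no
    contradiction yet: the average forces t = 0, and then the choice \<open>s\<close> = 0 leaves x
    unchanged.\<close>
  then have "(\<Sum>k\<in>J. (t k)\<^sup>2) \<le> 0" using 5 by (simp add: algebra_simps)
  then have t0: "(\<Sum>k\<in>J. (t k)\<^sup>2) = 0" by (simp add: sum_nonneg antisym)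
  have "?B < D" using gt[OF _ p0, of 0] 4 by simp
  moreover have "D = (\<Sum>k\<in>J. (x k)\<^sup>2)"
  proof (cases "finite J")
    case True
    then have "t k = 0" if "k \<in> J" for k
      using t0 that by (simp add: sum_nonneg_eq_0_iff)
    then show ?thesis by (simp add: D_def)
  qed (simp add: D_def)
  moreover have "0 \<le> \<beta> * r\<^sup>2" using \<beta> by simp
  ultimately show False by linarith
qed

text \<open>The vector tracked is the unnormalised error after \<open>m\<close> picks. Each pick
  adds r * s * g p - t to it and raises its squared norm by at most \<beta> * r^2, so the growth is
  linear in \<open>m\<close>.\<close>

lemma greedy_atom_sum:
  fixes g :: "'p \<Rightarrow> 'k \<Rightarrow> real"
  assumes I: "finite I" "I \<noteq> {}"
    and g: "\<And>p. p \<in> I \<Longrightarrow> (\<Sum>k\<in>J. (g p k)\<^sup>2) \<le> \<beta>"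
    and c: "(\<Sum>p\<in>I. \<bar>c p\<bar>) \<le> r" and r: "0 < r"
    and t: "\<And>k. k \<in> J \<Longrightarrow> t k = (\<Sum>p\<in>I. c p * g p k)"
  shows "\<exists>ws. set ws \<subseteq> {-1,0,1} \<times> I \<and> length ws = m \<and>
    (\<Sum>k\<in>J. (r * (\<Sum>(s,p)\<leftarrow>ws. s * g p k) - real m * t k)\<^sup>2) \<le> real m * (\<beta> * r\<^sup>2)"
proof (induction m)
  case 0
  then show ?case by simp
next
  case (Suc m)
  then obtain ws where ws: "set ws \<subseteq> {-1,0,1} \<times> I" "length ws = m"
    "(\<Sum>k\<in>J. (r * (\<Sum>(s,p)\<leftarrow>ws. s * g p k) - real m * t k)\<^sup>2) \<le> real m * (\<beta> * r\<^sup>2)" by blast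
  obtain s p where sp: "s \<in> {-1,0,1}" "p \<in> I"
    "(\<Sum>k\<in>J. ((r * (\<Sum>(s,p)\<leftarrow>ws. s * g p k) - real m * t k) + r * (s * g p k) - t k)\<^sup>2)
      \<le> (\<Sum>k\<in>J. (r * (\<Sum>(s,p)\<leftarrow>ws. s * g p k) - real m * t k)\<^sup>2) + \<beta> * r\<^sup>2"
    using greedy_atom_step[OF I g c r t, where x = "\<lambda>k. r * (\<Sum>(s,p)\<leftarrow>ws. s * g p k) - real m * t k"]
    by blast
  have "(\<Sum>k\<in>J. (r * (\<Sum>(s,p)\<leftarrow>(s, p) # ws. s * g p k) - real (Suc m) * t k)\<^sup>2) =
     (\<Sum>k\<in>J. ((r * (\<Sum>(s,p)\<leftarrow>ws. s * g p k) - real m * t k) + r * (s * g p k) - t k)\<^sup>2)"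
    by (intro sum.cong refl arg_cong[where f = "\<lambda>y. y\<^sup>2"]) (simp add: algebra_simps)
  also have "\<dots> \<le> real (Suc m) * (\<beta> * r\<^sup>2)" using sp(3) ws(3) by (simp add: algebra_simps)
  finally show ?case using sp(1,2) ws(1,2) by (intro exI[of _ "(s, p) # ws"]) auto
qed

text \<open>Maurey's empirical method, derandomised: atoms are picked greedily.\<close>

lemma maurey_approximation:
  fixes g :: "'p \<Rightarrow> 'k \<Rightarrow> real"
  assumes I: "finite I" "I \<noteq> {}"
    and g: "\<And>p. p \<in> I \<Longrightarrow> (\<Sum>k\<in>J. (g p k)\<^sup>2) \<le> \<beta>"
    and c: "(\<Sum>p\<in>I. \<bar>c p\<bar>) \<le> r" and r: "0 < r"
    and t: "\<And>k. k \<in> J \<Longrightarrow> t k = (\<Sum>p\<in>I. c p * g p k)" and m: "0 < m"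
  shows "\<exists>ws. set ws \<subseteq> {-1,0,1} \<times> I \<and> length ws = m \<and>
    (\<Sum>k\<in>J. (r / m * (\<Sum>(s,p)\<leftarrow>ws. s * g p k) - t k)\<^sup>2) \<le> \<beta> * r\<^sup>2 / m"
proof -
  obtain ws where ws: "set ws \<subseteq> {-1,0,1} \<times> I" "length ws = m"
    "(\<Sum>k\<in>J. (r * (\<Sum>(s,p)\<leftarrow>ws. s * g p k) - real m * t k)\<^sup>2) \<le> real m * (\<beta> * r\<^sup>2)"
    using greedy_atom_sum[OF I g c r t] by blast
  have "(\<Sum>k\<in>J. (r / m * (\<Sum>(s,p)\<leftarrow>ws. s * g p k) - t k)\<^sup>2) =
    (\<Sum>k\<in>J. (r * (\<Sum>(s,p)\<leftarrow>ws. s * g p k) - real m * t k)\<^sup>2) / (real m)\<^sup>2"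
    unfolding sum_divide_distrib power_divide[symmetric]
    by (intro sum.cong refl arg_cong[where f = "\<lambda>y. y\<^sup>2"]) (use m in \<open>simp add: field_simps\<close>)
  also have "\<dots> \<le> real m * (\<beta> * r\<^sup>2) / (real m)\<^sup>2"
    by (intro divide_right_mono ws) auto
  also have "\<dots> = \<beta> * r\<^sup>2 / m" using m by (simp add: power2_eq_square)
  finally show ?thesis using ws by blast
qed

section \<open>Segment decompositions of vectors of small total variation\<close>

definition segments :: "nat \<Rightarrow> nat \<Rightarrow> (nat \<times> nat) set" where
  "segments N L = {(a, b). 1 \<le> a \<and> a \<le> b \<and> b \<le> N \<and> b < a + L}"

definition seg :: "nat \<times> nat \<Rightarrow> nat \<Rightarrow> real" where
  "seg p j = (if fst p \<le> j \<and> j \<le> snd p then 1 else 0)"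

text \<open>The atomic norm ball: r times the absolutely convex hull of the segments, which is the
  input of Maurey's method. The identity is required at every index, so such a \<open>y\<close>
  vanishes off {1..N}.\<close>

definition seg_span :: "nat \<Rightarrow> nat \<Rightarrow> real \<Rightarrow> (nat \<Rightarrow> real) \<Rightarrow> bool" where
  "seg_span N L r y \<longleftrightarrow> (\<exists>c. (\<Sum>p\<in>segments N L. \<bar>c p\<bar>) \<le> r \<and>
     (\<forall>j. y j = (\<Sum>p\<in>segments N L. c p * seg p j)))"

lemma segments_subset: "segments N L \<subseteq> {1..N} \<times> {1..N}"
  by (auto simp: segments_def)

lemma finite_segments [simp]: "finite (segments N L)"
  using finite_subset[OF segments_subset] by blast

lemma card_segments: "card (segments N L) \<le> N\<^sup>2"
  using card_mono[OF _ segments_subset[of N L]] by (simp add: power2_eq_square)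

lemma seg_norm:
  assumes "p \<in> segments N L"
  shows "0 < (\<Sum>j=1..N. (seg p j)\<^sup>2)" "(\<Sum>j=1..N. (seg p j)\<^sup>2) \<le> L"
proof -
  obtain a b where p: "p = (a, b)" "1 \<le> a" "a \<le> b" "b \<le> N" "b < a + L"
    using assms by (auto simp: segments_def)
  have "(\<Sum>j=1..N. (seg p j)\<^sup>2) = (\<Sum>j\<in>{a..b}. 1)"
    using p by (intro sum.mono_neutral_cong_right) (auto simp: seg_def)
  also have "\<dots> = real (b + 1 - a)" by simp
  finally have "(\<Sum>j=1..N. (seg p j)\<^sup>2) = real (b + 1 - a)" .
  then show "0 < (\<Sum>j=1..N. (seg p j)\<^sup>2)" "(\<Sum>j=1..N. (seg p j)\<^sup>2) \<le> L"
    using p by auto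
qed

lemma seg_span_seg:
  assumes "p \<in> segments N L"
  shows "seg_span N L \<bar>u\<bar> (\<lambda>j. u * seg p j)"
  unfolding seg_span_def
proof (intro exI conjI allI)
  let ?c = "\<lambda>q. if q = p then u else 0"
  have "(\<Sum>q\<in>segments N L. \<bar>?c q\<bar>) = (\<Sum>q\<in>segments N L. if q = p then \<bar>u\<bar> else 0)"
    by (intro sum.cong) auto
  then show "(\<Sum>q\<in>segments N L. \<bar>?c q\<bar>) \<le> \<bar>u\<bar>" using assms by (simp add: sum.delta)
  have "(\<Sum>q\<in>segments N L. ?c q * seg q j) = (\<Sum>q\<in>segments N L. if q = p then u * seg p j else 0)"
    for j by (intro sum.cong) auto
  then show "u * seg p j = (\<Sum>q\<in>segments N L. ?c q * seg q j)" for j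
    using assms by (simp add: sum.delta)
qed

lemma seg_span_add:
  assumes "seg_span N L r x" "seg_span N L s y"
  shows "seg_span N L (r + s) (\<lambda>j. x j + y j)"
proof -
  obtain c d where c: "(\<Sum>p\<in>segments N L. \<bar>c p\<bar>) \<le> r" "\<And>j. x j = (\<Sum>p\<in>segments N L. c p * seg p j)"
    and d: "(\<Sum>p\<in>segments N L. \<bar>d p\<bar>) \<le> s" "\<And>j. y j = (\<Sum>p\<in>segments N L. d p * seg p j)"
    using assms unfolding seg_span_def by blast
  have "(\<Sum>p\<in>segments N L. \<bar>c p + d p\<bar>) \<le> (\<Sum>p\<in>segments N L. \<bar>c p\<bar> + \<bar>d p\<bar>)"
    by (intro sum_mono) auto
  then have "(\<Sum>p\<in>segments N L. \<bar>c p + d p\<bar>) \<le> r + s" using c d by (simp add: sum.distrib)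
  moreover have "x j + y j = (\<Sum>p\<in>segments N L. (c p + d p) * seg p j)" for j
    using c d by (simp add: sum.distrib algebra_simps)
  ultimately show ?thesis unfolding seg_span_def by (intro exI[of _ "\<lambda>p. c p + d p"]) auto
qed

lemma seg_span_mono: "seg_span N L r x \<Longrightarrow> r \<le> s \<Longrightarrow> seg_span N L s x"
  unfolding seg_span_def by (meson order_trans)

lemma seg_span_0: "0 \<le> r \<Longrightarrow> seg_span N L r (\<lambda>j. 0)"
  unfolding seg_span_def by (intro exI[of _ "\<lambda>_. 0"]) auto

lemma seg_span_sum:
  assumes "finite S" "\<And>i. i \<in> S \<Longrightarrow> seg_span N L (r i) (x i)"
  shows "seg_span N L (\<Sum>i\<in>S. r i) (\<lambda>j. \<Sum>i\<in>S. x i j)"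
  using assms by (induction S) (auto intro: seg_span_0 seg_span_add)

lemma telescope_fin_diff:
  assumes "i \<le> j"
  shows "(\<Sum>k\<in>{i..<j}. fin_diff z k) = z j - z i"
  using assms sum_Suc_diff'[of i j z] by (simp add: fin_diff_def)

text \<open>On a short block, \<open>z\<close> is its value at a reference index plus jumps pointing away from it.\<close>

lemma block_decomposition:
  assumes "a \<le> k" "k \<le> b"
  shows "z j * seg (a, b) j = z k * seg (a, b) j
     + (\<Sum>i\<in>{k..<b}. fin_diff z i * seg (i + 1, b) j)
     + (\<Sum>i\<in>{a..<k}. - fin_diff z i * seg (a, i) j)"
proof -
  consider "j < a \<or> b < j" | "a \<le> j" "j < k" | "k \<le> j" "j \<le> b" using assms by linarith
  then show ?thesis
  proof cases
    case 1
    then show ?thesis using assms by (auto simp: seg_def intro!: sum.neutral)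
  next
    case 2
    have "(\<Sum>i\<in>{k..<b}. fin_diff z i * seg (i + 1, b) j) = 0"
      using 2 by (intro sum.neutral) (auto simp: seg_def)
    moreover have "(\<Sum>i\<in>{a..<k}. - fin_diff z i * seg (a, i) j) = (\<Sum>i\<in>{j..<k}. - fin_diff z i)"
      using 2 by (intro sum.mono_neutral_cong_right) (auto simp: seg_def)
    ultimately show ?thesis
      using 2 assms telescope_fin_diff[of j k z] by (simp add: seg_def sum_negf)
  next
    case 3
    have "(\<Sum>i\<in>{a..<k}. - fin_diff z i * seg (a, i) j) = 0"
      using 3 by (intro sum.neutral) (auto simp: seg_def)
    moreover have "(\<Sum>i\<in>{k..<b}. fin_diff z i * seg (i + 1, b) j) = (\<Sum>i\<in>{k..<j}. fin_diff z i)"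
      using 3 by (intro sum.mono_neutral_cong_right) (auto simp: seg_def)
    ultimately show ?thesis
      using 3 assms telescope_fin_diff[of k j z] by (simp add: seg_def)
  qed
qed

text \<open>Each jump inside the block is charged once, so only the level at the reference index
  costs extra. Leaving \<open>k\<close> free allows an index where |z| is small.\<close>

lemma seg_span_block:
  assumes ab: "1 \<le> a" "b \<le> N" "b < a + L" and k: "a \<le> k" "k \<le> b"
  shows "seg_span N L (\<bar>z k\<bar> + (\<Sum>i\<in>{a..<b}. \<bar>fin_diff z i\<bar>)) (\<lambda>j. z j * seg (a, b) j)"
proof -
  have "seg_span N L ((\<bar>z k\<bar> + (\<Sum>i\<in>{k..<b}. \<bar>fin_diff z i\<bar>)) + (\<Sum>i\<in>{a..<k}. \<bar>- fin_diff z i\<bar>))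
     (\<lambda>j. (z k * seg (a, b) j + (\<Sum>i\<in>{k..<b}. fin_diff z i * seg (i + 1, b) j))
     + (\<Sum>i\<in>{a..<k}. - fin_diff z i * seg (a, i) j))"
    by (intro seg_span_add seg_span_sum seg_span_seg)
       (use ab k in \<open>auto simp: segments_def\<close>)
  moreover have "(\<Sum>i\<in>{a..<b}. \<bar>fin_diff z i\<bar>) =
      (\<Sum>i\<in>{k..<b}. \<bar>fin_diff z i\<bar>) + (\<Sum>i\<in>{a..<k}. \<bar>fin_diff z i\<bar>)"
    using k sum.atLeastLessThan_concat[of a k b "\<lambda>i. \<bar>fin_diff z i\<bar>"] by simp
  ultimately show ?thesis using block_decomposition[OF k, of z] by (simp add: add.assoc)
qed

text \<open>Induction that strips off the last \<open>L\<close> indices. A full block costs its mean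
  of |z| plus its inner variation; the summand 1 pays for the reference value of the short block at
  the front.\<close>

lemma seg_span_prefix:
  assumes L: "1 \<le> L" and b: "\<And>j. 1 \<le> j \<Longrightarrow> j \<le> N \<Longrightarrow> \<bar>z j\<bar> \<le> 1" and n: "n \<le> N"
  shows "seg_span N L (1 + (\<Sum>j=1..n. \<bar>z j\<bar>) / L + (\<Sum>i\<in>{1..<n}. \<bar>fin_diff z i\<bar>))
     (\<lambda>j. z j * seg (1, n) j)"
  using n
proof (induction n rule: less_induct)
  case (less n)
  consider "n = 0" | "1 \<le> n" "n \<le> L" | "L < n" by linarith
  then show ?case
  proof cases
    case 1
    then have "seg (1, n) = (\<lambda>_. 0)" by (auto simp: seg_def fun_eq_iff)
    then show ?thesis using 1 seg_span_0[of 1] by simp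
  next
    case 2
    have "0 \<le> (\<Sum>j=1..n. \<bar>z j\<bar>) / L" by (intro divide_nonneg_nonneg sum_nonneg) auto
    with b[of n] 2 less.prems
    have "\<bar>z n\<bar> + (\<Sum>i\<in>{1..<n}. \<bar>fin_diff z i\<bar>)
        \<le> 1 + (\<Sum>j=1..n. \<bar>z j\<bar>) / L + (\<Sum>i\<in>{1..<n}. \<bar>fin_diff z i\<bar>)" by linarith
    then show ?thesis
      using 2 less.prems by (intro seg_span_mono[OF seg_span_block[where k = n]]) auto
  next
    case 3
    define l where "l = n - L"
    have l: "1 \<le> l" "l < n" "n = l + L" using 3 L by (auto simp: l_def)
    let ?B = "{l+1..n}"
    \<comment> \<open>A block of exactly \<open>L\<close> indices contains one where |z| does not
      exceed the block mean.\<close>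
    have "\<exists>k\<in>?B. \<bar>z k\<bar> \<le> (\<Sum>j\<in>?B. \<bar>z j\<bar>) / L"
    proof (rule ccontr)
      assume "\<not> ?thesis"
      then have "(\<Sum>k\<in>?B. (\<Sum>j\<in>?B. \<bar>z j\<bar>) / L) < (\<Sum>k\<in>?B. \<bar>z k\<bar>)"
        using l by (intro sum_strict_mono) (auto simp: not_le)
      then show False using l L by simp
    qed
    then obtain k where k: "k \<in> ?B" "\<bar>z k\<bar> \<le> (\<Sum>j\<in>?B. \<bar>z j\<bar>) / L" by blast
    have A: "seg_span N L (\<bar>z k\<bar> + (\<Sum>i\<in>{l+1..<n}. \<bar>fin_diff z i\<bar>)) (\<lambda>j. z j * seg (l+1, n) j)"
      using k l less.prems by (intro seg_span_block) auto
    have P: "seg_span N L (1 + (\<Sum>j=1..l. \<bar>z j\<bar>) / L + (\<Sum>i\<in>{1..<l}. \<bar>fin_diff z i\<bar>))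
       (\<lambda>j. z j * seg (1, l) j)"
      using l less.prems by (intro less.IH) linarith+
    have "seg_span N L ((1 + (\<Sum>j=1..l. \<bar>z j\<bar>) / L + (\<Sum>i\<in>{1..<l}. \<bar>fin_diff z i\<bar>))
       + (\<bar>z k\<bar> + (\<Sum>i\<in>{l+1..<n}. \<bar>fin_diff z i\<bar>)))
       (\<lambda>j. z j * seg (1, l) j + z j * seg (l+1, n) j)" (is "seg_span _ _ ?r ?x")
      by (rule seg_span_add[OF P A])
    moreover have "?x = (\<lambda>j. z j * seg (1, n) j)"
      using l by (auto simp: seg_def fun_eq_iff)
    moreover have "?r \<le> 1 + (\<Sum>j=1..n. \<bar>z j\<bar>) / L + (\<Sum>i\<in>{1..<n}. \<bar>fin_diff z i\<bar>)"
    proof -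
      have 1: "(\<Sum>j=1..n. \<bar>z j\<bar>) = (\<Sum>j=1..l. \<bar>z j\<bar>) + (\<Sum>j\<in>?B. \<bar>z j\<bar>)"
        using l sum.ub_add_nat[of 1 l "\<lambda>j. \<bar>z j\<bar>" L] by simp
      \<comment> \<open>The jump \<open>fin_diff z l\<close> between the two blocks occurs in
        neither expansion and is simply given away.\<close>
      have 2: "(\<Sum>i\<in>{1..<n}. \<bar>fin_diff z i\<bar>) =
          (\<Sum>i\<in>{1..<l}. \<bar>fin_diff z i\<bar>) + (\<bar>fin_diff z l\<bar> + (\<Sum>i\<in>{l+1..<n}. \<bar>fin_diff z i\<bar>))"
        using l sum.atLeastLessThan_concat[of 1 l n "\<lambda>i. \<bar>fin_diff z i\<bar>"]
        by (simp add: sum.atLeast_Suc_lessThan)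
      show ?thesis using k(2) unfolding 1 2 by (simp add: add_divide_distrib)
    qed
    ultimately show ?thesis using seg_span_mono[of N L ?r ?x] by simp
  qed
qed

section \<open>Violating vectors and the choice of the block length\<close>

lemma sum_abs_le_sqrt_card:
  fixes f :: "'a \<Rightarrow> real"
  shows "(\<Sum>i\<in>S. \<bar>f i\<bar>) \<le> sqrt (card S) * sqrt (\<Sum>i\<in>S. (f i)\<^sup>2)"
proof -
  have "(\<Sum>i\<in>S. \<bar>1\<bar> * \<bar>f i\<bar>) \<le> L2_set (\<lambda>_. 1) S * L2_set f S"
    by (rule L2_set_mult_ineq)
  then show ?thesis by (simp add: L2_set_def)
qed

text \<open>The unit l2 norm gives |z j| \<le> 1 and, by Cauchy-Schwarz, l1 norm at most sqrt N. It
  also bounds the l2 norm of \<open>fin_diff z\<close> by 2, hence its l1 norm on \<open>S\<close>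
  by 2 * sqrt K, and the cone condition doubles this for the total variation.\<close>

lemma tv_cone_seg_span:
  assumes N: "1 \<le> N" and L: "1 \<le> L" and unit: "(\<Sum>j=1..N. (z j)\<^sup>2) = 1"
    and S: "S \<subseteq> {1..N - 1}" "card S \<le> K"
    and cone: "l1_on ({1..N - 1} - S) (fin_diff z) \<le> l1_on S (fin_diff z)"
  shows "seg_span N L (1 + sqrt N / L + 4 * sqrt K) (\<lambda>j. z j * seg (1, N) j)"
proof -
  have bound: "\<bar>z j\<bar> \<le> 1" if "1 \<le> j" "j \<le> N" for j
  proof -
    have "(z j)\<^sup>2 \<le> (\<Sum>j=1..N. (z j)\<^sup>2)"
      using that by (intro member_le_sum) auto
    then show ?thesis using unit by (simp add: abs_square_le_1)
  qed
  have l1: "(\<Sum>j=1..N. \<bar>z j\<bar>) \<le> sqrt N"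
    using sum_abs_le_sqrt_card[of z "{1..N}"] unit by simp
  have shift: "(\<Sum>i=1..N-1. (z (i + 1))\<^sup>2) = (\<Sum>i=2..N. (z i)\<^sup>2)"
    using N by (intro sum.reindex_bij_witness[of _ "\<lambda>i. i - 1" "\<lambda>i. i + 1"]) auto
  have "(\<Sum>i=1..N-1. (z (i + 1))\<^sup>2) \<le> 1" "(\<Sum>i=1..N-1. (z i)\<^sup>2) \<le> 1"
    unfolding shift unit[symmetric] by (rule sum_mono2; auto)+
  then have D2: "(\<Sum>i=1..N-1. 2 * (z (i + 1))\<^sup>2 + 2 * (z i)\<^sup>2) \<le> 4"
    by (simp add: sum.distrib sum_distrib_left[symmetric])
  have "(\<Sum>i\<in>S. (fin_diff z i)\<^sup>2) \<le> (\<Sum>i=1..N-1. (fin_diff z i)\<^sup>2)"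
    using S by (intro sum_mono2) auto
  also have "\<dots> \<le> (\<Sum>i=1..N-1. 2 * (z (i + 1))\<^sup>2 + 2 * (z i)\<^sup>2)"
  proof (rule sum_mono)
    fix i show "(fin_diff z i)\<^sup>2 \<le> 2 * (z (i + 1))\<^sup>2 + 2 * (z i)\<^sup>2"
      using zero_le_power2[of "z (i + 1) + z i"]
      by (simp add: fin_diff_def power2_eq_square algebra_simps)
  qed
  finally have "sqrt (\<Sum>i\<in>S. (fin_diff z i)\<^sup>2) \<le> sqrt 4"
    using D2 by (intro real_sqrt_le_mono) linarith
  then have "sqrt (card S) * sqrt (\<Sum>i\<in>S. (fin_diff z i)\<^sup>2) \<le> sqrt K * 2"
    using S by (intro mult_mono) (auto intro: sum_nonneg)
  then have lS: "l1_on S (fin_diff z) \<le> 2 * sqrt K"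
    using sum_abs_le_sqrt_card[of "fin_diff z" S] by (simp add: l1_on_def)
  have "(\<Sum>i\<in>{1..N - 1}. \<bar>fin_diff z i\<bar>) =
      l1_on ({1..N - 1} - S) (fin_diff z) + l1_on S (fin_diff z)"
    unfolding l1_on_def using S by (intro sum.subset_diff) auto
  moreover have "{1..<N} = {1..N - 1}" using N by auto
  ultimately have tv: "(\<Sum>i\<in>{1..<N}. \<bar>fin_diff z i\<bar>) \<le> 4 * sqrt K"
    using cone lS by simp
  show ?thesis
    by (rule seg_span_mono[OF seg_span_prefix[OF L bound order_refl]])
       (use l1 tv L in \<open>auto intro!: add_mono divide_right_mono\<close>)
qed

text \<open>This block length balances sqrt N / L against sqrt K. With q = sqrt (N * K), the
  quantities L, N / L and K * L are at most 2q, q and 2q; as (1 + a + b)^2 is at most three times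
  the sum of squares, the constant is 105 = 3 * (2 + 1 + 16 * 2).\<close>

lemma block_length_estimate:
  fixes N K :: nat
  assumes "1 \<le> K" "K \<le> N"
  defines "L \<equiv> nat \<lceil>sqrt (N / K)\<rceil>"
  shows "1 \<le> L" "L * (1 + sqrt N / L + 4 * sqrt K)\<^sup>2 \<le> 105 * sqrt (real N * real K)"
proof -
  define x where "x = sqrt (N / K)"
  define q where "q = sqrt (real N * real K)"
  have x1: "1 \<le> x" using assms by (simp add: x_def)
  have Lx: "x \<le> L" "L \<le> 2 * x" using x1 unfolding L_def x_def[symmetric] by linarith+
  then show L1: "1 \<le> L" using x1 by linarith
  have Kx: "K * x = q"
    using assms by (simp add: x_def q_def real_sqrt_divide real_sqrt_mult field_simps)
  have qx: "q * x = N"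
    using assms by (simp add: x_def q_def real_sqrt_divide real_sqrt_mult field_simps)
  have q0: "0 \<le> q" by (simp add: q_def)
  have xq: "x \<le> q" using Kx x1 assms mult_right_mono[of 1 "real K" x] by simp
  have "N / L \<le> q"
    using L1 Lx mult_left_mono[OF Lx(1) q0] qx by (simp add: field_simps)
  moreover have "real K * L \<le> 2 * q" using mult_left_mono[OF Lx(2), of "real K"] Kx by simp
  moreover have "3 * (l + v + 16 * u) \<le> 105 * q" if "l \<le> 2 * x" "v \<le> q" "u \<le> 2 * q" for l u v
    using that xq by argo
  ultimately have est: "3 * (L + N / L + 16 * (real K * L)) \<le> 105 * q" using Lx(2) by blast
  define a where "a = sqrt N / L"
  define b where "b = 4 * sqrt K"
  have sq: "(1 + a + b)\<^sup>2 \<le> 3 * (1 + a\<^sup>2 + b\<^sup>2)"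
    using zero_le_power2[of "a - b"] zero_le_power2[of "a - 1"] zero_le_power2[of "b - 1"]
    by (simp add: power2_eq_square algebra_simps)
  have "L * (1 + a + b)\<^sup>2 \<le> L * (3 * (1 + a\<^sup>2 + b\<^sup>2))" by (intro mult_left_mono sq) auto
  also have "\<dots> = 3 * (L + N / L + 16 * (real K * L))"
    using L1 by (simp add: a_def b_def power_mult_distrib power_divide power2_eq_square field_simps)
  finally show "L * (1 + sqrt N / L + 4 * sqrt K)\<^sup>2 \<le> 105 * sqrt (real N * real K)"
    using est unfolding a_def b_def q_def by linarith
qed

section \<open>Approximating kernel vectors by averages of segments\<close>

definition seg_comb :: "real \<Rightarrow> (real \<times> nat \<times> nat) list \<Rightarrow> nat \<Rightarrow> real" where
  "seg_comb r ws j = r / length ws * (\<Sum>(s,p)\<leftarrow>ws. s * seg p j)"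

lemma mat_vec_sum:
  "mat_vec N A (\<lambda>j. \<Sum>p\<in>I. c p * f p j) i = (\<Sum>p\<in>I. c p * mat_vec N A (f p) i)"
  unfolding mat_vec_def sum_distrib_left by (subst sum.swap) (simp add: mult_ac)

lemma mat_vec_scale: "mat_vec N A (\<lambda>j. u * x j) i = u * mat_vec N A x i"
  by (simp add: mat_vec_def sum_distrib_left mult_ac)

lemma mat_vec_add: "mat_vec N A (\<lambda>j. x j + y j) i = mat_vec N A x i + mat_vec N A y i"
  by (simp add: mat_vec_def sum.distrib algebra_simps)

lemma mat_vec_seg_comb:
  "mat_vec N A (seg_comb r ws) i = r / length ws * (\<Sum>(s,p)\<leftarrow>ws. s * mat_vec N A (seg p) i)"
proof -
  have "mat_vec N A (\<lambda>j. \<Sum>(s,p)\<leftarrow>ws. s * seg p j) i = (\<Sum>(s,p)\<leftarrow>ws. s * mat_vec N A (seg p) i)"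
  proof (induction ws)
    case Nil
    then show ?case by (simp add: mat_vec_def)
  next
    case (Cons w ws)
    then show ?case by (cases w) (simp add: mat_vec_add mat_vec_scale)
  qed
  then show ?thesis unfolding seg_comb_def mat_vec_scale by simp
qed

text \<open>Maurey's method runs on stacked vectors: an atom is a segment together with its scaled
  image under \<open>A\<close>, the target is \<open>y\<close> together with 0. One list then
  approximates both halves at once, and 3200 = 2 * 1600 makes the error 2 * L * r^2 / m at most
  1/1600.\<close>

lemma kernel_approximation:
  assumes y: "seg_span N L r y" "(\<Sum>j=1..N. (y j)\<^sup>2) = 1"
    and pos: "0 < r" "1 \<le> L" "1 \<le> N" "1 \<le> M" "0 < m"
    and A: "\<And>p. p \<in> segments N L \<Longrightarrow> (\<Sum>i=1..M. (mat_vec N A (seg p) i)\<^sup>2) \<le> 8 * real M * L"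
    and Ay: "\<And>i. i \<in> {1..M} \<Longrightarrow> mat_vec N A y i = 0"
    and m: "3200 * (L * r\<^sup>2) \<le> m"
  shows "\<exists>ws. set ws \<subseteq> {-1,0,1} \<times> segments N L \<and> length ws = m \<and>
    1 / 4 \<le> (\<Sum>j=1..N. (seg_comb r ws j)\<^sup>2) \<and>
    (\<Sum>i=1..M. (mat_vec N A (seg_comb r ws) i)\<^sup>2) \<le> M / 200"
proof -
  let ?I = "segments N L"
  let ?J = "{1..N} <+> {1..M}"
  \<comment> \<open>Dividing images by \<open>b\<close> turns the hypothesis on segments into the
    bound \<open>L\<close>, so both halves of an atom have squared norm at most
    \<open>L\<close>.\<close>
  define b where "b = sqrt (8 * M)"
  have b: "0 < b" "b\<^sup>2 = 8 * M" using pos by (auto simp: b_def)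
  define g where "g p = case_sum (seg p) (\<lambda>i. mat_vec N A (seg p) i / b)" for p
  define t where "t = case_sum y (\<lambda>_::nat. 0::real)"
  obtain c where c: "(\<Sum>p\<in>?I. \<bar>c p\<bar>) \<le> r" "\<And>j. y j = (\<Sum>p\<in>?I. c p * seg p j)"
    using y(1) unfolding seg_span_def by blast
  have "(1, 1) \<in> ?I" using pos by (auto simp: segments_def)
  then have ne: "?I \<noteq> {}" by blast
  have g: "(\<Sum>k\<in>?J. (g p k)\<^sup>2) \<le> 2 * real L" if "p \<in> ?I" for p
  proof -
    have "(\<Sum>k\<in>?J. (g p k)\<^sup>2) =
        (\<Sum>j=1..N. (seg p j)\<^sup>2) + (\<Sum>i=1..M. (mat_vec N A (seg p) i)\<^sup>2) / (8 * M)"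
      by (simp add: sum.Plus g_def power_divide b(2) sum_divide_distrib)
    also have "(\<Sum>i=1..M. (mat_vec N A (seg p) i)\<^sup>2) / (8 * M) \<le> L"
      using A[OF that] pos by (simp add: field_simps)
    finally show ?thesis using seg_norm(2)[OF that] by simp
  qed
  have yfun: "y = (\<lambda>j. \<Sum>p\<in>?I. c p * seg p j)" using c(2) by blast
  \<comment> \<open>The coefficients of \<open>y\<close> also represent 0 in the image half, because
    \<open>y\<close> lies in the kernel.\<close>
  have t: "t k = (\<Sum>p\<in>?I. c p * g p k)" if "k \<in> ?J" for k
  proof -
    have "(\<Sum>p\<in>?I. c p * (mat_vec N A (seg p) i / b)) = 0" if "i \<in> {1..M}" for i
      using Ay[OF that] yfun by (simp add: mat_vec_sum sum_divide_distrib[symmetric])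
    then show ?thesis using that by (auto simp: t_def g_def c(2))
  qed
  obtain ws where ws: "set ws \<subseteq> {-1,0,1} \<times> ?I" "length ws = m"
    and err: "(\<Sum>k\<in>?J. (r / m * (\<Sum>(s,p)\<leftarrow>ws. s * g p k) - t k)\<^sup>2) \<le> 2 * real L * r\<^sup>2 / m"
    using maurey_approximation[OF finite_segments ne g c(1) pos(1) t pos(5)] by blast
  let ?x = "seg_comb r ws"
  have "(\<Sum>(s,p)\<leftarrow>ws. s * g p (Inr i)) = (\<Sum>(s,p)\<leftarrow>ws. s * mat_vec N A (seg p) i) / b"
    for i by (induction ws) (auto simp: g_def add_divide_distrib)
  moreover have "g p (Inl j) = seg p j" for p j by (simp add: g_def)
  ultimately have "(\<Sum>k\<in>?J. (r / m * (\<Sum>(s,p)\<leftarrow>ws. s * g p k) - t k)\<^sup>2) =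
     (\<Sum>j=1..N. (?x j - y j)\<^sup>2) + (\<Sum>i=1..M. (mat_vec N A ?x i / b)\<^sup>2)"
    by (simp add: sum.Plus t_def mat_vec_seg_comb ws(2) mult.commute[of b])
       (simp add: seg_comb_def ws(2))
  moreover
  have "2 * real L * r\<^sup>2 / m \<le> 1 / 1600" using m pos by (simp add: field_simps)
  ultimately have e: "(\<Sum>j=1..N. (?x j - y j)\<^sup>2) + (\<Sum>i=1..M. (mat_vec N A ?x i / b)\<^sup>2) \<le> 1 / 1600"
    using err by linarith
  have e1: "0 \<le> (\<Sum>j=1..N. (?x j - y j)\<^sup>2)" "0 \<le> (\<Sum>i=1..M. (mat_vec N A ?x i / b)\<^sup>2)"
    by (auto intro: sum_nonneg)
  have "(\<Sum>i=1..M. (mat_vec N A ?x i / b)\<^sup>2) \<le> 1 / 1600" using e e1 by linarith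
  \<comment> \<open>Undoing the scaling: 8 * M / 1600 = M / 200.\<close>
  then have 1: "(\<Sum>i=1..M. (mat_vec N A ?x i)\<^sup>2) \<le> M / 200"
    using pos by (simp add: power_divide b(2) sum_divide_distrib[symmetric] field_simps)
  \<comment> \<open>This leaves squared norm at least 1/2 - 1/1600 for the average; 1/4 is a
    convenient weakening.\<close>
  have "1 \<le> (\<Sum>j=1..N. 2 * (?x j)\<^sup>2 + 2 * (?x j - y j)\<^sup>2)"
    unfolding y(2)[symmetric]
  proof (rule sum_mono)
    fix j
    show "(y j)\<^sup>2 \<le> 2 * (?x j)\<^sup>2 + 2 * (?x j - y j)\<^sup>2"
      using zero_le_power2[of "2 * ?x j - y j"] by (simp add: power2_eq_square algebra_simps)
  qed
  also have "\<dots> = 2 * (\<Sum>j=1..N. (?x j)\<^sup>2) + 2 * (\<Sum>j=1..N. (?x j - y j)\<^sup>2)"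
    by (simp add: sum.distrib sum_distrib_left)
  finally have "1 / 4 \<le> (\<Sum>j=1..N. (?x j)\<^sup>2)" using e e1 by linarith
  with 1 ws show ?thesis by blast
qed

section \<open>Gaussian matrices\<close>

abbreviation std_normal :: "real measure" where
  "std_normal \<equiv> density lborel (\<lambda>x. ennreal (std_normal_density x))"

lemma prob_space_gaussian_matrix: "prob_space (gaussian_matrix M N)"
  unfolding gaussian_matrix_def
  by (intro prob_space_PiM prob_space_normal_density) simp

lemma gaussian_matrix_entry_measurable [measurable]:
  assumes "p \<in> {1..M} \<times> {1..N}"
  shows "(\<lambda>A. A p) \<in> borel_measurable (gaussian_matrix M N)"
proof -
  have "(\<lambda>A. A p) \<in> measurable (gaussian_matrix M N) std_normal"
    unfolding gaussian_matrix_def by (rule measurable_component_singleton[OF assms])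
  then show ?thesis by simp
qed

lemma mat_vec_measurable:
  assumes "i \<in> {1..M}"
  shows "(\<lambda>A. mat_vec N A w i) \<in> borel_measurable (gaussian_matrix M N)"
  unfolding mat_vec_def using assms
  by (intro borel_measurable_sum borel_measurable_times gaussian_matrix_entry_measurable) auto

lemma gaussian_matrix_entry_distributed:
  assumes "p \<in> {1..M} \<times> {1..N}"
  shows "distributed (gaussian_matrix M N) lborel (\<lambda>A. A p) std_normal_density"
proof -
  have "distr (gaussian_matrix M N) std_normal (\<lambda>A. A p) = std_normal"
    unfolding gaussian_matrix_def
    by (rule distr_PiM_component[OF _ assms]) (intro prob_space_normal_density, simp)
  then have "distr (gaussian_matrix M N) lborel (\<lambda>A. A p) = std_normal"
    by (simp cong: distr_cong)
  then show ?thesis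
    using gaussian_matrix_entry_measurable[OF assms] by (simp add: distributed_def)
qed

text \<open>The joint law of the coordinates is the product of their marginals, which characterises
  independence over a nonempty index set.\<close>

lemma gaussian_matrix_indep_entries:
  "prob_space.indep_vars (gaussian_matrix M N) (\<lambda>_. borel) (\<lambda>p A. A p) ({1..M} \<times> {1..N})"
proof (cases "{1..M} \<times> {1..N} = {}")
  case True
  interpret prob_space "gaussian_matrix M N" by (rule prob_space_gaussian_matrix)
  show ?thesis unfolding True by (simp add: indep_vars_def indep_sets_def)
next
  case False
  interpret prob_space "gaussian_matrix M N" by (rule prob_space_gaussian_matrix)
  let ?I = "{1..M} \<times> {1..N}"
  have s: "sets (\<Pi>\<^sub>M p \<in> ?I. borel) = sets (gaussian_matrix M N)"
    unfolding gaussian_matrix_def by (intro sets_PiM_cong) auto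
  have "distr (gaussian_matrix M N) (\<Pi>\<^sub>M p \<in> ?I. borel) (\<lambda>A. \<lambda>p\<in>?I. A p)
      = distr (gaussian_matrix M N) (gaussian_matrix M N) (\<lambda>A. A)"
    by (intro distr_cong s refl) (auto simp: gaussian_matrix_def space_PiM)
  also have "\<dots> = (\<Pi>\<^sub>M p \<in> ?I. distr (gaussian_matrix M N) borel (\<lambda>A. A p))"
  proof -
    have "distr (gaussian_matrix M N) borel (\<lambda>A. A p) = std_normal" if "p \<in> ?I" for p
      using distributed_distr_eq_density[OF gaussian_matrix_entry_distributed[OF that]]
      by (simp cong: distr_cong)
    then have "(\<Pi>\<^sub>M p \<in> ?I. distr (gaussian_matrix M N) borel (\<lambda>A. A p)) = gaussian_matrix M N"
      unfolding gaussian_matrix_def[of M N, symmetric]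
      by (subst gaussian_matrix_def[of M N]) (intro PiM_cong refl, auto)
    then show ?thesis by (simp add: distr_id)
  qed
  finally show ?thesis
    using False gaussian_matrix_entry_measurable by (subst indep_vars_iff_distr_eq_PiM') auto
qed

text \<open>Different rows depend on disjoint sets of entries.\<close>

lemma gaussian_matrix_indep_rows:
  "prob_space.indep_vars (gaussian_matrix M N) (\<lambda>_. borel) (\<lambda>i A. mat_vec N A w i) {1..M}"
proof -
  interpret prob_space "gaussian_matrix M N" by (rule prob_space_gaussian_matrix)
  have "indep_vars (\<lambda>i. PiM ({i} \<times> {1..N}) (\<lambda>_. borel))
     (\<lambda>i A. restrict (\<lambda>p. A p) ({i} \<times> {1..N})) {1..M}"
    by (rule indep_vars_restrict[OF gaussian_matrix_indep_entries])
       (auto simp: disjoint_family_on_def)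
  then have "indep_vars (\<lambda>_. borel)
     (\<lambda>i A. (\<lambda>f. \<Sum>j=1..N. f (i, j) * w j) (restrict (\<lambda>p. A p) ({i} \<times> {1..N}))) {1..M}"
    by (rule indep_vars_compose2)
       (intro borel_measurable_sum borel_measurable_times measurable_component_singleton; auto)
  then show ?thesis by (simp add: mat_vec_def)
qed

lemma gaussian_matrix_row_distributed:
  assumes i: "i \<in> {1..M}" and w: "0 < (\<Sum>j=1..N. (w j)\<^sup>2)"
  shows "distributed (gaussian_matrix M N) lborel (\<lambda>A. mat_vec N A w i)
    (normal_density 0 (sqrt (\<Sum>j=1..N. (w j)\<^sup>2)))"
proof -
  interpret prob_space "gaussian_matrix M N" by (rule prob_space_gaussian_matrix)
  \<comment> \<open>Entries of weight 0 are dropped, since each summand must have a normal density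
    with positive deviation.\<close>
  let ?J = "{j\<in>{1..N}. w j \<noteq> 0}"
  have ne: "?J \<noteq> {}"
  proof
    assume e: "?J = {}"
    have "(\<Sum>j=1..N. (w j)\<^sup>2) = 0" by (intro sum.neutral) (use e in auto)
    with w show False by simp
  qed
  have "indep_vars (\<lambda>j. PiM {(i, j)} (\<lambda>_. borel)) (\<lambda>j A. restrict (\<lambda>p. A p) {(i, j)}) ?J"
    by (rule indep_vars_restrict[OF gaussian_matrix_indep_entries])
       (use i in \<open>auto simp: disjoint_family_on_def\<close>)
  then have "indep_vars (\<lambda>_. borel) (\<lambda>j A. (\<lambda>f. f (i, j) * w j) (restrict (\<lambda>p. A p) {(i, j)})) ?J"
    by (rule indep_vars_compose2)
       (intro borel_measurable_times measurable_component_singleton; auto)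
  then have "indep_vars (\<lambda>_. borel) (\<lambda>j A. A (i, j) * w j) ?J" by simp
  moreover have "distributed (gaussian_matrix M N) lborel (\<lambda>A. A (i, j) * w j) (normal_density 0 \<bar>w j\<bar>)"
    if "j \<in> ?J" for j
  proof -
    have "distributed (gaussian_matrix M N) lborel (\<lambda>A. 0 + w j * A (i, j))
        (normal_density (0 + w j * 0) (\<bar>w j\<bar> * 1))"
      by (rule normal_density_affine[OF gaussian_matrix_entry_distributed]) (use i that in auto)
    then show ?thesis by (simp add: mult.commute)
  qed
  ultimately have "distributed (gaussian_matrix M N) lborel (\<lambda>A. \<Sum>j\<in>?J. A (i, j) * w j)
      (normal_density (\<Sum>j\<in>?J. 0) (sqrt (\<Sum>j\<in>?J. \<bar>w j\<bar>\<^sup>2)))"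
    using ne by (intro sum_indep_normal) auto
  moreover have "(\<Sum>j\<in>?J. \<bar>w j\<bar>\<^sup>2) = (\<Sum>j=1..N. (w j)\<^sup>2)"
    by (intro sum.mono_neutral_cong_left) auto
  moreover have "(\<Sum>j\<in>?J. A (i, j) * w j) = mat_vec N A w i" for A
    unfolding mat_vec_def by (intro sum.mono_neutral_cong_left) auto
  ultimately show ?thesis by simp
qed

text \<open>Tilting by exp (\<theta> * x^2) divides the variance by 1 - 2 * \<theta> * \<sigma>^2.
  The leading factor is therefore the moment generating function of the squared normal variable at
  \<theta>, which may be negative.\<close>

lemma normal_density_times_exp_square:
  assumes "0 < \<sigma>" "2 * \<theta> * \<sigma>\<^sup>2 < 1"
  shows "normal_density 0 \<sigma> x * exp (\<theta> * x\<^sup>2) =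
    1 / sqrt (1 - 2 * \<theta> * \<sigma>\<^sup>2) * normal_density 0 (\<sigma> / sqrt (1 - 2 * \<theta> * \<sigma>\<^sup>2)) x"
proof -
  define d where "d = 1 - 2 * \<theta> * \<sigma>\<^sup>2"
  have d: "0 < d" using assms by (simp add: d_def)
  have "exp (- x\<^sup>2 / (2 * \<sigma>\<^sup>2)) * exp (\<theta> * x\<^sup>2) = exp (- (x\<^sup>2 * d / (2 * \<sigma>\<^sup>2)))"
    unfolding exp_add[symmetric] using assms(1)
    by (intro arg_cong[where f = exp]) (simp add: d_def field_simps)
  moreover have "1 / sqrt (2 * pi * \<sigma>\<^sup>2) = 1 / sqrt d * (1 / sqrt (2 * pi * (\<sigma> / sqrt d)\<^sup>2))"
    using d assms(1) by (simp add: power_divide real_sqrt_mult real_sqrt_divide)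
  moreover have "(\<sigma> / sqrt d)\<^sup>2 = \<sigma>\<^sup>2 / d" using d by (simp add: power_divide)
  ultimately show ?thesis
    unfolding normal_density_def d_def[symmetric] by (simp add: mult.assoc)
qed

text \<open>Markov's inequality for exp (\<theta> * |A w|^2 - x), whose mean factors over the
  independent rows. With \<theta> inside the event, \<theta> > 0 yields the upper tail and \<theta>
  < 0 the lower tail.\<close>

lemma gaussian_matrix_chernoff:
  assumes w: "0 < (\<Sum>j=1..N. (w j)\<^sup>2)" and \<theta>: "2 * \<theta> * (\<Sum>j=1..N. (w j)\<^sup>2) < 1"
  shows "measure (gaussian_matrix M N)
      {A \<in> space (gaussian_matrix M N). x \<le> \<theta> * (\<Sum>i=1..M. (mat_vec N A w i)\<^sup>2)}
    \<le> exp (- x) * (1 / sqrt (1 - 2 * \<theta> * (\<Sum>j=1..N. (w j)\<^sup>2))) ^ M"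
proof -
  interpret prob_space "gaussian_matrix M N" by (rule prob_space_gaussian_matrix)
  let ?G = "gaussian_matrix M N"
  define \<sigma> where "\<sigma> = sqrt (\<Sum>j=1..N. (w j)\<^sup>2)"
  have \<sigma>: "0 < \<sigma>" "\<sigma>\<^sup>2 = (\<Sum>j=1..N. (w j)\<^sup>2)" using w by (auto simp: \<sigma>_def)
  define D where "D = 1 / sqrt (1 - 2 * \<theta> * \<sigma>\<^sup>2)"
  have \<theta>': "2 * \<theta> * \<sigma>\<^sup>2 < 1" using \<theta> by (simp only: \<sigma>(2))
  have D: "0 \<le> D" using \<theta> by (simp add: D_def \<sigma>(2))
  note mat_vec_measurable [measurable]
  let ?X = "\<lambda>i A. ennreal (exp (\<theta> * (mat_vec N A w i)\<^sup>2))"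
  have row: "(\<integral>\<^sup>+A. ?X i A \<partial>?G) = ennreal D" if "i \<in> {1..M}" for i
  proof -
    have "(\<integral>\<^sup>+A. ?X i A \<partial>?G) = (\<integral>\<^sup>+x. ennreal (normal_density 0 \<sigma> x) * ennreal (exp (\<theta> * x\<^sup>2)) \<partial>lborel)"
      using distributed_nn_integral[OF gaussian_matrix_row_distributed[OF that w],
          of "\<lambda>x. ennreal (exp (\<theta> * x\<^sup>2))"]
      by (simp add: \<sigma>_def)
    also have "\<dots> = (\<integral>\<^sup>+x. ennreal D * ennreal (normal_density 0 (\<sigma> * D) x) \<partial>lborel)"
      using normal_density_times_exp_square[OF \<sigma>(1) \<theta>'] D
      by (simp add: D_def ennreal_mult'[symmetric] normal_density_nonneg)
    also have "\<dots> = ennreal D * (\<integral>\<^sup>+x. ennreal (normal_density 0 (\<sigma> * D) x) \<partial>lborel)"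
      by (intro nn_integral_cmult) auto
    also have "(\<integral>\<^sup>+x. ennreal (normal_density 0 (\<sigma> * D) x) \<partial>lborel) = 1"
    proof -
      have "0 < \<sigma> * D" using \<sigma> \<theta>' by (simp add: D_def)
      then have "emeasure (density lborel (normal_density 0 (\<sigma> * D))) UNIV = 1"
        using prob_space.emeasure_space_1[OF prob_space_normal_density[of "\<sigma> * D" 0]] by simp
      then show ?thesis by (simp add: emeasure_density)
    qed
    finally show ?thesis by simp
  qed
  have "indep_vars (\<lambda>_. borel) (\<lambda>i A. (\<lambda>y. ennreal (exp (\<theta> * y\<^sup>2))) (mat_vec N A w i)) {1..M}"
    by (rule indep_vars_compose2[OF gaussian_matrix_indep_rows]) auto
  then have "(\<integral>\<^sup>+A. (\<Prod>i=1..M. ?X i A) \<partial>?G) = (\<Prod>i=1..M. \<integral>\<^sup>+A. ?X i A \<partial>?G)"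
    by (intro indep_vars_nn_integral) auto
  also have "\<dots> = ennreal (D ^ M)" using D by (simp add: row ennreal_power)
  finally have int: "(\<integral>\<^sup>+A. (\<Prod>i=1..M. ?X i A) \<partial>?G) = ennreal (D ^ M)" .
  let ?u = "\<lambda>A. \<Prod>i=1..M. ?X i A"
  have u: "?u A = ennreal (exp (\<theta> * (\<Sum>i=1..M. (mat_vec N A w i)\<^sup>2)))" for A
    by (simp add: prod_ennreal exp_sum sum_distrib_left)
  have "{A \<in> space ?G. x \<le> \<theta> * (\<Sum>i=1..M. (mat_vec N A w i)\<^sup>2)} =
      {A \<in> space ?G. 1 \<le> ennreal (exp (- x)) * ?u A}"
    unfolding u by (simp add: ennreal_mult'[symmetric] exp_add[symmetric])
  moreover have "emeasure ?G {A \<in> space ?G. 1 \<le> ennreal (exp (- x)) * ?u A} \<le>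
      ennreal (exp (- x)) * (\<integral>\<^sup>+A. ?u A * indicator (space ?G) A \<partial>?G)"
    by (intro nn_integral_Markov_inequality borel_measurable_times borel_measurable_prod_ennreal) measurable
  moreover have "(\<integral>\<^sup>+A. ?u A * indicator (space ?G) A \<partial>?G) = ennreal (D ^ M)"
    unfolding int[symmetric] by (intro nn_integral_cong) simp
  ultimately have "emeasure ?G {A \<in> space ?G. x \<le> \<theta> * (\<Sum>i=1..M. (mat_vec N A w i)\<^sup>2)}
      \<le> ennreal (exp (- x) * D ^ M)"
    by (simp add: ennreal_mult')
  then show ?thesis
    using D by (simp add: emeasure_eq_measure D_def \<sigma>(2))
qed

section \<open>Measurability of the null space property\<close>

text \<open>Normalised witnesses against the null space property. Zero entries off {1..N} and unit
  norm make this set compact in the product topology.\<close>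

definition tv_cone :: "nat \<Rightarrow> nat \<Rightarrow> (nat \<Rightarrow> real) set" where
  "tv_cone N K = {z. (\<forall>j. j \<notin> {1..N} \<longrightarrow> z j = 0) \<and> (\<Sum>j=1..N. (z j)\<^sup>2) = 1 \<and>
     (\<exists>S\<in>{S. S \<subseteq> {1..N - 1} \<and> card S \<le> K}.
       l1_on ({1..N - 1} - S) (fin_diff z) \<le> l1_on S (fin_diff z))}"

text \<open>The kernel condition and the violated inequality are invariant under positive scaling
  and see only the entries in {1..N}, so a violating vector may be rescaled and cut off.\<close>

lemma not_tv_nsp_iff:
  "\<not> tv_nsp M N K A \<longleftrightarrow> (\<exists>z\<in>tv_cone N K. \<forall>i\<in>{1..M}. mat_vec N A z i = 0)"
proof
  assume "\<exists>z\<in>tv_cone N K. \<forall>i\<in>{1..M}. mat_vec N A z i = 0"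
  then obtain z S where z: "(\<Sum>j=1..N. (z j)\<^sup>2) = 1" "\<forall>i\<in>{1..M}. mat_vec N A z i = 0"
    and S: "S \<subseteq> {1..N - 1}" "card S \<le> K"
      "l1_on ({1..N - 1} - S) (fin_diff z) \<le> l1_on S (fin_diff z)"
    unfolding tv_cone_def by blast
  have "\<exists>j\<in>{1..N}. z j \<noteq> 0"
  proof (rule ccontr)
    assume "\<not> ?thesis"
    then have "(\<Sum>j=1..N. (z j)\<^sup>2) = 0" by (intro sum.neutral) auto
    with z(1) show False by simp
  qed
  with z S show "\<not> tv_nsp M N K A" unfolding tv_nsp_def by (meson not_le)
next
  assume "\<not> tv_nsp M N K A"
  then obtain z S where z: "\<exists>j\<in>{1..N}. z j \<noteq> 0" "\<And>i. i \<in> {1..M} \<Longrightarrow> mat_vec N A z i = 0"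
    and S: "S \<subseteq> {1..N - 1}" "card S \<le> K"
      "l1_on ({1..N - 1} - S) (fin_diff z) \<le> l1_on S (fin_diff z)"
    unfolding tv_nsp_def by (meson not_le)
  define n where "n = sqrt (\<Sum>j=1..N. (z j)\<^sup>2)"
  have "0 < (\<Sum>j=1..N. (z j)\<^sup>2)" using z(1) by (auto intro!: sum_pos2)
  then have n: "0 < n" "n\<^sup>2 = (\<Sum>j=1..N. (z j)\<^sup>2)" by (auto simp: n_def)
  define y where "y j = (if j \<in> {1..N} then z j / n else 0)" for j
  have "(\<Sum>j=1..N. (y j)\<^sup>2) = (\<Sum>j=1..N. (z j)\<^sup>2) / n\<^sup>2"
    by (simp add: y_def power_divide sum_divide_distrib)
  then have y1: "(\<Sum>j=1..N. (y j)\<^sup>2) = 1" using n(1) by (simp only: n(2)[symmetric]) simp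
  have d: "l1_on T (fin_diff y) = l1_on T (fin_diff z) / n" if "T \<subseteq> {1..N - 1}" for T
    unfolding l1_on_def sum_divide_distrib
  proof (intro sum.cong refl)
    fix i assume "i \<in> T"
    \<comment> \<open>Differences up to index N - 1 reach at most entry N, so they never touch what
      was cut off.\<close>
    then have "1 \<le> i" "i + 1 \<le> N" using that by force+
    then show "\<bar>fin_diff y i\<bar> = \<bar>fin_diff z i\<bar> / n"
      using n by (simp add: fin_diff_def y_def diff_divide_distrib[symmetric])
  qed
  have "l1_on ({1..N - 1} - S) (fin_diff y) \<le> l1_on S (fin_diff y)"
    using S n by (simp add: d divide_right_mono)
  with S y1 have "y \<in> tv_cone N K" unfolding tv_cone_def by (auto simp: y_def)
  moreover have "mat_vec N A y i = 0" if "i \<in> {1..M}" for i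
  proof -
    have "mat_vec N A y i = mat_vec N A z i / n"
      unfolding mat_vec_def sum_divide_distrib by (intro sum.cong) (auto simp: y_def)
    then show ?thesis using z(2)[OF that] by simp
  qed
  ultimately show "\<exists>z\<in>tv_cone N K. \<forall>i\<in>{1..M}. mat_vec N A z i = 0" by blast
qed

text \<open>A closed subset of a product of intervals [-1, 1], which is compact by Tychonoff. The
  existential over \<open>S\<close> stays closed because it is a finite union.\<close>

lemma compact_tv_cone: "compact (tv_cone N K)"
proof -
  let ?B = "PiE UNIV (\<lambda>_. {-1..1}) :: (nat \<Rightarrow> real) set"
  have B: "compact ?B"
    using compactin_PiE[of "\<lambda>_::nat. euclidean::real topology" UNIV "\<lambda>_. {-1..1}"]
    by (simp add: euclidean_product_topology)
  have fin: "finite {S. S \<subseteq> {1..N - 1} \<and> card S \<le> K}" by simp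
  have "closed (\<Union>S\<in>{S. S \<subseteq> {1..N - 1} \<and> card S \<le> K}.
      {z. l1_on ({1..N - 1} - S) (fin_diff z) \<le> l1_on S (fin_diff z)})"
    unfolding l1_on_def fin_diff_def
    by (intro closed_UN[OF fin] ballI closed_Collect_le continuous_intros
        continuous_on_product_coordinates)
  then have "closed {z. \<exists>S\<in>{S. S \<subseteq> {1..N - 1} \<and> card S \<le> K}.
      l1_on ({1..N - 1} - S) (fin_diff z) \<le> l1_on S (fin_diff z)}"
    by (simp only: Collect_bex_eq)
  then have c: "closed (tv_cone N K)"
    unfolding tv_cone_def
    by (intro closed_Collect_conj closed_Collect_all closed_Collect_imp
        closed_Collect_eq open_Collect_const continuous_intros
        continuous_on_product_coordinates)
  have "tv_cone N K \<subseteq> ?B"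
  proof
    fix z assume z: "z \<in> tv_cone N K"
    have "\<bar>z j\<bar> \<le> 1" for j
    proof (cases "j \<in> {1..N}")
      case True
      then have "(z j)\<^sup>2 \<le> (\<Sum>j=1..N. (z j)\<^sup>2)" by (intro member_le_sum) auto
      then show ?thesis using z by (simp add: tv_cone_def abs_square_le_1)
    qed (use z in \<open>auto simp: tv_cone_def\<close>)
    then show "z \<in> ?B" by (auto simp: abs_le_iff minus_le_iff)
  qed
  then show ?thesis using compact_Int_closed[OF B c] by (simp add: Int_absorb1)
qed

text \<open>The uncountable quantifier over the cone is replaced by a countable dense subset
  \<open>D\<close>. By compactness |A z|^2 attains its minimum on the cone, so a kernel vector
  exists exactly when |A z|^2 falls below every 1 / (n + 1) on \<open>D\<close>.\<close>

lemma tv_nsp_sets: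
  "{A \<in> space (gaussian_matrix M N). tv_nsp M N K A} \<in> sets (gaussian_matrix M N)"
proof -
  let ?G = "gaussian_matrix M N"
  define Q where "Q A z = (\<Sum>i=1..M. (mat_vec N A z i)\<^sup>2)" for A z
  obtain D where D: "countable D" "D \<subseteq> tv_cone N K" "tv_cone N K \<subseteq> closure D"
    using separable by blast
  have cont: "continuous_on UNIV (Q A)" for A
    unfolding Q_def mat_vec_def by (intro continuous_intros continuous_on_product_coordinates)
  have Q0: "Q A z = 0 \<longleftrightarrow> (\<forall>i\<in>{1..M}. mat_vec N A z i = 0)" for A z
    unfolding Q_def by (subst sum_nonneg_eq_0_iff) auto
  have "\<not> tv_nsp M N K A \<longleftrightarrow> (\<forall>n::nat. \<exists>z\<in>D. Q A z < 1 / Suc n)" for A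
  proof
    assume "\<not> tv_nsp M N K A"
    then obtain z where z: "z \<in> tv_cone N K" "Q A z = 0" using not_tv_nsp_iff Q0 by metis
    show "\<forall>n::nat. \<exists>z\<in>D. Q A z < 1 / Suc n"
    proof
      fix n :: nat
      have "open {z. Q A z < 1 / Suc n}"
        by (intro open_Collect_less cont continuous_intros)
      moreover have "z \<in> {z. Q A z < 1 / Suc n} \<inter> closure D" using z D(3) by auto
      ultimately have "{z. Q A z < 1 / Suc n} \<inter> D \<noteq> {}"
        using open_Int_closure_eq_empty by blast
      then show "\<exists>z\<in>D. Q A z < 1 / Suc n" by blast
    qed
  next
    assume *: "\<forall>n::nat. \<exists>z\<in>D. Q A z < 1 / Suc n"
    then have "tv_cone N K \<noteq> {}" using D(2) by blast
    then obtain z where z: "z \<in> tv_cone N K" "\<And>y. y \<in> tv_cone N K \<Longrightarrow> Q A z \<le> Q A y"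
      using continuous_attains_inf[OF compact_tv_cone, of N K "Q A"] continuous_on_subset[OF cont]
      by blast
    have "Q A z \<le> 0"
    proof (rule ccontr)
      assume "\<not> ?thesis"
      then obtain n where n: "1 / Suc n < Q A z"
        using nat_approx_posE[of "Q A z"] by (auto simp: not_le)
      obtain y where "y \<in> D" "Q A y < 1 / Suc n" using * by blast
      then show False using z(2)[of y] D(2) n by force
    qed
    moreover have "0 \<le> Q A z" unfolding Q_def by (intro sum_nonneg) auto
    ultimately show "\<not> tv_nsp M N K A" using z(1) Q0 not_tv_nsp_iff by (metis antisym)
  qed
  then have "{A \<in> space ?G. tv_nsp M N K A}
      = {A \<in> space ?G. \<not> (\<forall>n::nat. \<exists>z\<in>D. Q A z < 1 / Suc n)}" by blast
  also have "\<dots> \<in> sets ?G"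
  proof (intro sets.sets_Collect_neg sets.sets_Collect_countable_All sets.sets_Collect_countable_Ex'[OF _ D(1)])
    fix n z
    have "(\<lambda>A. Q A z) \<in> borel_measurable ?G"
      unfolding Q_def by (intro borel_measurable_sum borel_measurable_power mat_vec_measurable)
    then show "{A \<in> space ?G. Q A z < 1 / Suc n} \<in> sets ?G" by measurable
  qed
  finally show ?thesis .
qed

section \<open>The union bound\<close>

lemma exp_2_le_10: "exp (2::real) \<le> 10"
proof -
  have "exp (2::real) = exp 1 * exp 1" unfolding exp_add[symmetric] by simp
  also have "\<dots> \<le> 3 * 3" using exp_le by (intro mult_mono) auto
  finally show ?thesis by simp
qed

text \<open>Chernoff with \<theta> = 1 / (4 * L): the threshold becomes 2 * M, and since segments
  have squared norm at most \<open>L\<close>, each row contributes a factor at most 2 \<le> exp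
  1.\<close>

lemma seg_image_tail:
  assumes p: "p \<in> segments N L"
  shows "measure (gaussian_matrix M N)
      {A \<in> space (gaussian_matrix M N). 8 * real M * L \<le> (\<Sum>i=1..M. (mat_vec N A (seg p) i)\<^sup>2)}
    \<le> exp (- real M)"
proof -
  let ?s = "\<Sum>j=1..N. (seg p j)\<^sup>2"
  note s = seg_norm[OF p]
  have L: "0 < real L" using s by linarith
  have \<theta>: "2 * (1 / (4 * real L)) * ?s \<le> 1 / 2" using s L by (simp add: field_simps)
  have "{A \<in> space (gaussian_matrix M N). 8 * real M * L \<le> (\<Sum>i=1..M. (mat_vec N A (seg p) i)\<^sup>2)} =
    {A \<in> space (gaussian_matrix M N).
      2 * real M \<le> 1 / (4 * real L) * (\<Sum>i=1..M. (mat_vec N A (seg p) i)\<^sup>2)}"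
    using L by (simp add: field_simps)
  then have "measure (gaussian_matrix M N)
      {A \<in> space (gaussian_matrix M N). 8 * real M * L \<le> (\<Sum>i=1..M. (mat_vec N A (seg p) i)\<^sup>2)}
    \<le> exp (- (2 * real M)) * (1 / sqrt (1 - 2 * (1 / (4 * real L)) * ?s)) ^ M"
    using gaussian_matrix_chernoff[OF s(1), of "1 / (4 * real L)" M "2 * real M"] \<theta> by simp
  also have "\<dots> \<le> exp (- (2 * real M)) * (exp 1) ^ M"
  proof (intro mult_left_mono power_mono)
    \<comment> \<open>1/4 replaces 1/2 for the sake of a rational square root.\<close>
    have "sqrt (1 / 4) \<le> sqrt (1 - 2 * (1 / (4 * real L)) * ?s)"
      using \<theta> by (intro real_sqrt_le_mono) linarith
    then have "1 / sqrt (1 - 2 * (1 / (4 * real L)) * ?s) \<le> 1 / (1 / 2)"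
      by (intro frac_le) (auto simp: real_sqrt_divide)
    also have "1 / (1 / 2) = (2::real)" by simp
    also have "2 \<le> exp (1::real)" using exp_ge_add_one_self[of "1::real"] by simp
    finally show "1 / sqrt (1 - 2 * (1 / (4 * real L)) * ?s) \<le> exp 1" .
    show "0 \<le> 1 / sqrt (1 - 2 * (1 / (4 * real L)) * ?s)" using \<theta> by simp
  qed auto
  also have "\<dots> = exp (- real M)"
    by (simp add: exp_of_nat_mult[symmetric] exp_add[symmetric])
  finally show ?thesis .
qed

text \<open>Chernoff with the negative parameter -200, which turns the threshold M / 200 into - M.
  The resulting factor exp M is beaten by a factor exp (-2) from each row.\<close>

lemma small_image_tail:
  assumes w: "1 / 4 \<le> (\<Sum>j=1..N. (w j)\<^sup>2)"
  shows "measure (gaussian_matrix M N)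
      {A \<in> space (gaussian_matrix M N). (\<Sum>i=1..M. (mat_vec N A w i)\<^sup>2) \<le> M / 200}
    \<le> exp (- real M)"
proof -
  let ?s = "\<Sum>j=1..N. (w j)\<^sup>2"
  have s: "0 < ?s" using w by linarith
  have "{A \<in> space (gaussian_matrix M N). (\<Sum>i=1..M. (mat_vec N A w i)\<^sup>2) \<le> M / 200} =
    {A \<in> space (gaussian_matrix M N). - real M \<le> (-200) * (\<Sum>i=1..M. (mat_vec N A w i)\<^sup>2)}"
    by (auto simp: field_simps)
  then have "measure (gaussian_matrix M N)
      {A \<in> space (gaussian_matrix M N). (\<Sum>i=1..M. (mat_vec N A w i)\<^sup>2) \<le> M / 200}
    \<le> exp (real M) * (1 / sqrt (1 - 2 * (-200) * ?s)) ^ M"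
    using gaussian_matrix_chernoff[OF s, of "-200" M "- real M"] s by simp
  also have "\<dots> \<le> exp (real M) * (exp (-2)) ^ M"
  proof (intro mult_left_mono power_mono)
    \<comment> \<open>1 + 400 / 4 = 101 exceeds 10^2, and 10 exceeds exp 2.\<close>
    have "sqrt (10\<^sup>2) \<le> sqrt (1 - 2 * (-200) * ?s)"
      using w by (intro real_sqrt_le_mono) simp
    then have "exp 2 \<le> sqrt (1 - 2 * (-200) * ?s)" using exp_2_le_10 by simp
    then have "1 / sqrt (1 - 2 * (-200) * ?s) \<le> 1 / exp 2" by (intro frac_le) auto
    then show "1 / sqrt (1 - 2 * (-200) * ?s) \<le> exp (-2)" by (simp add: exp_minus field_simps)
    show "0 \<le> 1 / sqrt (1 - 2 * (-200) * ?s)" using s by simp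
  qed auto
  also have "\<dots> = exp (- real M)"
    by (simp add: exp_of_nat_mult[symmetric] exp_add[symmetric])
  finally show ?thesis .
qed

text \<open>Union bound over events fixed in advance: a segment has a large image, or an average of
  norm at least 1/2 has a small one. Outside these events the approximation of a violating kernel
  vector would itself be such an average. A list entry has 3 signs and at most N^2 segments to
  choose from.\<close>

lemma tv_nsp_failure_bound:
  fixes M N K m :: nat
  assumes K: "1 \<le> K" "K \<le> N" and M: "1 \<le> M"
    and m: "336000 * sqrt (real N * real K) \<le> m"
  shows "measure (gaussian_matrix M N) {A \<in> space (gaussian_matrix M N). \<not> tv_nsp M N K A}
    \<le> 2 * (3 * real N ^ 2) ^ m * exp (- real M)"
proof -
  interpret prob_space "gaussian_matrix M N" by (rule prob_space_gaussian_matrix)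
  let ?G = "gaussian_matrix M N"
  have [measurable]: "(\<lambda>A. \<Sum>i=1..M. (mat_vec N A w i)\<^sup>2) \<in> borel_measurable ?G" for w
    by (intro borel_measurable_sum borel_measurable_power mat_vec_measurable)
  define L where "L = nat \<lceil>sqrt (N / K)\<rceil>"
  define r where "r = 1 + sqrt N / L + 4 * sqrt K"
  have L: "1 \<le> L" and Lr: "L * r\<^sup>2 \<le> 105 * sqrt (real N * real K)"
    using block_length_estimate[OF K] by (simp_all add: L_def r_def)
  have r: "0 < r" by (simp add: r_def add_pos_nonneg)
  have N: "1 \<le> N" using K by simp
  have "0 < sqrt (real N * real K)" using N K by simp
  then have "0 < real m" using m by linarith
  then have m0: "0 < m" by simp
  \<comment> \<open>336000 = 3200 * 105.\<close>
  have m': "3200 * (L * r\<^sup>2) \<le> m" using Lr m by linarith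
  let ?Q = "{-1,0,1::real} \<times> segments N L"
  \<comment> \<open>\<open>W\<close> does not depend on the matrix; its norm condition is the
    hypothesis of the lower tail bound.\<close>
  define W where "W = {ws. set ws \<subseteq> ?Q \<and> length ws = m \<and> 1 / 4 \<le> (\<Sum>j=1..N. (seg_comb r ws j)\<^sup>2)}"
  define E where "E p = {A \<in> space ?G. 8 * real M * L \<le> (\<Sum>i=1..M. (mat_vec N A (seg p) i)\<^sup>2)}" for p
  define F where "F ws = {A \<in> space ?G. (\<Sum>i=1..M. (mat_vec N A (seg_comb r ws) i)\<^sup>2) \<le> M / 200}" for ws
  have E_sets: "E p \<in> sets ?G" and F_sets: "F ws \<in> sets ?G" for p ws
    unfolding E_def F_def by measurable
  have W_sub: "W \<subseteq> {ws. set ws \<subseteq> ?Q \<and> length ws = m}" unfolding W_def by blast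
  have finQ: "finite ?Q" by simp
  have finW: "finite W" using finite_subset[OF W_sub finite_lists_length_eq[OF finQ]] .
  have "card ?Q \<le> 3 * N\<^sup>2" using card_segments[of N L] by (simp add: card_cartesian_product)
  then have cQ: "card ?Q ^ m \<le> (3 * N\<^sup>2) ^ m" by (intro power_mono) auto
  have "card W \<le> card ?Q ^ m"
    using card_mono[OF finite_lists_length_eq[OF finQ] W_sub] card_lists_length_eq[OF finQ]
    by (simp only:)
  also note cQ
  finally have "real (card W) \<le> real ((3 * N\<^sup>2) ^ m)" by (simp only: of_nat_le_iff)
  then have cW: "real (card W) \<le> (3 * real N ^ 2) ^ m" by simp
  have N2: "1 \<le> 3 * real N ^ 2" using N one_le_power[of "real N" 2] by linarith
  \<comment> \<open>A crude bound on the number of segments lets both sums merge into the factor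
    2.\<close>
  have "real (card (segments N L)) \<le> real (N\<^sup>2)"
    by (simp only: of_nat_le_iff card_segments)
  also have "\<dots> \<le> 3 * real N ^ 2" by simp
  also have "\<dots> \<le> (3 * real N ^ 2) ^ m" by (rule self_le_power[OF N2 m0])
  finally have cS: "real (card (segments N L)) \<le> (3 * real N ^ 2) ^ m" .
  have sub: "{A \<in> space ?G. \<not> tv_nsp M N K A} \<subseteq> (\<Union>p\<in>segments N L. E p) \<union> (\<Union>ws\<in>W. F ws)"
  proof (rule subsetI, rule ccontr)
    fix A assume A: "A \<in> {A \<in> space ?G. \<not> tv_nsp M N K A}"
      and nA: "A \<notin> (\<Union>p\<in>segments N L. E p) \<union> (\<Union>ws\<in>W. F ws)"
    obtain z where z: "z \<in> tv_cone N K" "\<And>i. i \<in> {1..M} \<Longrightarrow> mat_vec N A z i = 0"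
      using A not_tv_nsp_iff by blast
    then obtain S where zS: "\<And>j. j \<notin> {1..N} \<Longrightarrow> z j = 0" "(\<Sum>j=1..N. (z j)\<^sup>2) = 1"
      "S \<subseteq> {1..N - 1}" "card S \<le> K" "l1_on ({1..N - 1} - S) (fin_diff z) \<le> l1_on S (fin_diff z)"
      unfolding tv_cone_def by blast
    \<comment> \<open>z vanishes off {1..N}, so cutting it with the full segment changes
      nothing.\<close>
    have "(\<lambda>j. z j * seg (1, N) j) = z" using zS(1) by (auto simp: seg_def fun_eq_iff)
    then have span: "seg_span N L r z"
      using tv_cone_seg_span[OF N L zS(2-5)] by (simp add: r_def)
    have "(\<Sum>i=1..M. (mat_vec N A (seg p) i)\<^sup>2) \<le> 8 * real M * L" if "p \<in> segments N L" for p
      using nA A that by (auto simp: E_def not_le intro: less_imp_le)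
    then obtain ws where "set ws \<subseteq> ?Q" "length ws = m"
      "1 / 4 \<le> (\<Sum>j=1..N. (seg_comb r ws j)\<^sup>2)"
      "(\<Sum>i=1..M. (mat_vec N A (seg_comb r ws) i)\<^sup>2) \<le> M / 200"
      using kernel_approximation[OF span zS(2) r L N M m0 _ z(2) m'] by blast
    then show False using nA A unfolding W_def F_def by blast
  qed
  have "prob {A \<in> space ?G. \<not> tv_nsp M N K A} \<le> prob ((\<Union>p\<in>segments N L. E p) \<union> (\<Union>ws\<in>W. F ws))"
    by (intro finite_measure_mono sub sets.Un sets.finite_UN finite_segments finW E_sets F_sets)
  also have "\<dots> \<le> prob (\<Union>p\<in>segments N L. E p) + prob (\<Union>ws\<in>W. F ws)"
    by (intro measure_Un_le sets.finite_UN finite_segments finW E_sets F_sets)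
  also have "\<dots> \<le> (\<Sum>p\<in>segments N L. prob (E p)) + (\<Sum>ws\<in>W. prob (F ws))"
    by (intro add_mono measure_UNION_le finite_segments finW E_sets F_sets)
  also have "\<dots> \<le> (\<Sum>p\<in>segments N L. exp (- real M)) + (\<Sum>ws\<in>W. exp (- real M))"
  proof (intro add_mono sum_mono)
    show "prob (E p) \<le> exp (- real M)" if "p \<in> segments N L" for p
      unfolding E_def by (rule seg_image_tail[OF that])
    show "prob (F ws) \<le> exp (- real M)" if "ws \<in> W" for ws
      unfolding F_def by (rule small_image_tail) (use that in \<open>simp add: W_def\<close>)
  qed
  also have "\<dots> = (real (card (segments N L)) + real (card W)) * exp (- real M)"
    by (simp add: distrib_right)
  also have "\<dots> \<le> (2 * (3 * real N ^ 2) ^ m) * exp (- real M)"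
    using cS cW by (intro mult_right_mono) auto
  finally show ?thesis by simp
qed

section \<open>Choice of the constants and conclusion\<close>

theorem mainTheorem1:
  "\<exists>C::real. C > 0 \<and>
     (\<forall>\<eta>::real. \<eta> > 0 \<longrightarrow>
       (\<exists>N\<^sub>0::nat. \<forall>N K M :: nat.
          N \<ge> N\<^sub>0 \<and> 2 \<le> N \<and> 1 \<le> K \<and> K \<le> N - 1 \<and> 1 \<le> M \<and>
          real M \<ge> C * sqrt (real N * real K) * ln (real N) \<longrightarrow>
          measure (gaussian_matrix M N)
            {A \<in> space (gaussian_matrix M N). tv_nsp M N K A} \<ge> 1 - \<eta>))"
\<comment> \<open>With q = sqrt (N * K) and l = ln N, counting costs at most exp (3 * m * l) where m
  \<le> 336001 * q, an exponent of at most 1008003 * q * l. The constant 3000000 leaves room for a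
  further - l, that is, for decay like 1 / N.\<close>
proof (intro exI[of _ "3000000::real"] conjI allI impI)
  fix \<eta> :: real assume \<eta>: "0 < \<eta>"
  show "\<exists>N\<^sub>0::nat. \<forall>N K M :: nat.
          N \<ge> N\<^sub>0 \<and> 2 \<le> N \<and> 1 \<le> K \<and> K \<le> N - 1 \<and> 1 \<le> M \<and>
          real M \<ge> 3000000 * sqrt (real N * real K) * ln (real N) \<longrightarrow>
          measure (gaussian_matrix M N)
            {A \<in> space (gaussian_matrix M N). tv_nsp M N K A} \<ge> 1 - \<eta>"
  \<comment> \<open>The 3 serves for 3 * N^2 \<le> N^3, and 2 / \<eta> for 2 / N \<le> \<eta> at the
    end.\<close>
  proof (intro exI[of _ "max 3 (nat \<lceil>2 / \<eta>\<rceil>)"] allI impI, elim conjE)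
    fix N K M :: nat
    assume N: "N \<ge> max 3 (nat \<lceil>2 / \<eta>\<rceil>)" and K: "1 \<le> K" "K \<le> N - 1" and M: "1 \<le> M"
      and MC: "real M \<ge> 3000000 * sqrt (real N * real K) * ln (real N)"
    interpret prob_space "gaussian_matrix M N" by (rule prob_space_gaussian_matrix)
    let ?G = "gaussian_matrix M N"
    define q where "q = sqrt (real N * real K)"
    define m where "m = nat \<lceil>336000 * q\<rceil>"
    define l where "l = ln (real N)"
    have N3: "3 \<le> N" and N\<eta>: "2 / \<eta> \<le> N" using N by (auto simp: max_def split: if_splits) linarith+
    have l: "0 \<le> l" "exp l = N" using N3 by (auto simp: l_def)
    have "1 * 1 \<le> real N * real K" using N3 K by (intro mult_mono) auto
    then have q: "1 \<le> q" by (simp add: q_def)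
    \<comment> \<open>Rounding up adds at most 1 \<le> q.\<close>
    then have mq: "336000 * q \<le> m" "m \<le> 336001 * q" unfolding m_def by linarith+
    have "(3 * real N ^ 2) ^ m \<le> (real N ^ 3) ^ m"
      using N3 by (intro power_mono) (auto simp: power2_eq_square power3_eq_cube)
    also have "\<dots> = exp (3 * m * l)"
      unfolding l(2)[symmetric] exp_of_nat_mult[symmetric] by (simp add: mult_ac)
    finally have P: "(3 * real N ^ 2) ^ m \<le> exp (3 * m * l)" .
    have "m * l \<le> 336001 * q * l" using mq l by (intro mult_right_mono) auto
    then have "m * l \<le> 336001 * (q * l)" by (simp only: mult.assoc)
    moreover have "l \<le> q * l" using mult_right_mono[of 1 q l] q l by simp
    moreover have "3000000 * (q * l) \<le> M" using MC by (simp add: q_def l_def mult_ac)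
    moreover have "0 \<le> q * l" using q l by simp
    ultimately have "3 * (m * l) - M \<le> - l" by linarith
    then have e: "3 * m * l - M \<le> - l" by (simp only: mult.assoc)
    have "K \<le> N" using K by simp
    from tv_nsp_failure_bound[OF K(1) this M, of m] mq(1)
    have "prob {A \<in> space ?G. \<not> tv_nsp M N K A} \<le> 2 * (3 * real N ^ 2) ^ m * exp (- real M)"
      by (simp add: q_def)
    also have "\<dots> \<le> 2 * exp (3 * m * l) * exp (- real M)"
      using P by (intro mult_right_mono mult_left_mono) auto
    also have "\<dots> = 2 * exp (3 * m * l - M)" by (simp add: exp_diff exp_minus field_simps)
    also have "\<dots> \<le> 2 * exp (- l)" using e by simp
    also have "\<dots> = 2 / N" using l(2) by (simp add: exp_minus field_simps)
    also have "\<dots> \<le> \<eta>" using N\<eta> N3 \<eta> by (simp add: field_simps)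
    finally have "prob {A \<in> space ?G. \<not> tv_nsp M N K A} \<le> \<eta>" .
    moreover have "{A \<in> space ?G. \<not> tv_nsp M N K A} = space ?G - {A \<in> space ?G. tv_nsp M N K A}"
      by blast
    \<comment> \<open>Passing to the complement is where measurability of the event enters.\<close>
    ultimately show "1 - \<eta> \<le> prob {A \<in> space ?G. tv_nsp M N K A}"
      using prob_compl[OF tv_nsp_sets[of M N K]] by simp
  qed
qed simp

end
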